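(* If $M$ is a weakly sortable homogeneous manifold, then $NH(x)$ is discrete for each $x\in M$.
   Context: A manifold is a connected topological space each of whose points has a neighborhood homeomorphic to $\mathbb{R}^n$ for some fixed integer $n$ (not assumed Hausdorff). A space is homogeneous if for all points $x,y$ there is a self-homeomorphism sending $x$ to $y$. Two points are separated if they have disjoint open neighborhoods; $NH(x)$ is the set of points $y\neq x$ of $M$ which cannot be separated from $x$. An open Hausdorff subset $U$ of $M$ is weakly sorted if there are a Hausdorff space $H$ and a continuous map $f:\overline{U}\to H$ such that the restriction of $f$ to $U$ is finite-to-one. $M$ is weakly sortable if each point of $M$ has a weakly sorted (open Hausdorff) neighborhood. *)

theory Defs
  imports "HOL-Analysis.Analysis"
begin

definition manifold :: "'a topology \<Rightarrow> bool" where
  "manifold X \<longleftrightarrow> connected_space X \<and>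
     (\<exists>n. \<forall>x \<in> topspace X. \<exists>U. openin X U \<and> x \<in> U \<and>
        subtopology X U homeomorphic_space Euclidean_space n)"

definition homogeneous :: "'a topology \<Rightarrow> bool" where
  "homogeneous X \<longleftrightarrow>
     (\<forall>x \<in> topspace X. \<forall>y \<in> topspace X. \<exists>h. homeomorphic_map X X h \<and> h x = y)"

definition separated_points :: "'a topology \<Rightarrow> 'a \<Rightarrow> 'a \<Rightarrow> bool" where
  "separated_points X x y \<longleftrightarrow>
     (\<exists>U V. openin X U \<and> openin X V \<and> x \<in> U \<and> y \<in> V \<and> disjnt U V)"

definition NH :: "'a topology \<Rightarrow> 'a \<Rightarrow> 'a set" where
  "NH X x = {y \<in> topspace X. y \<noteq> x \<and> \<not> separated_points X x y}"

text \<open>HOL cannot quantify existentially over the underlying type of the Hausdorff space \<open>H\<close>,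
  so \<open>H\<close> is taken on the type of the space itself. This is no restriction: a target on an
  arbitrary type can be cut down to the image of the map and carried over to a set of
  representatives of its fibres, see \<open>weakly_sortedI\<close> below.\<close>

definition weakly_sorted :: "'a topology \<Rightarrow> 'a set \<Rightarrow> bool" where
  "weakly_sorted X U \<longleftrightarrow> openin X U \<and> Hausdorff_space (subtopology X U) \<and>
     (\<exists>(H :: 'a topology) f. Hausdorff_space H \<and>
        continuous_map (subtopology X (X closure_of U)) H f \<and>
        (\<forall>z \<in> topspace H. finite {u \<in> U. f u = z}))"

lemma weakly_sortedI:
  fixes X :: "'a topology" and H :: "'b topology"
  assumes U: "openin X U" "Hausdorff_space (subtopology X U)"
    and H: "Hausdorff_space H"
    and f: "continuous_map (subtopology X (X closure_of U)) H f"
    and fin: "\<And>z. z \<in> topspace H \<Longrightarrow> finite {u \<in> U. f u = z}"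
  shows "weakly_sorted X U"
proof -
  define C where "C = X closure_of U"
  define g where "g = inv_into C f \<circ> f"
  define K where "K = pullback_topology (g ` C) f H"
  have CX: "C \<subseteq> topspace X" and UC: "U \<subseteq> C"
    using U(1) by (auto simp: C_def closure_of_subset openin_subset closure_of_subset_topspace)
  have topC: "topspace (subtopology X C) = C"
    using CX by auto
  have fg: "f (g x) = f x" if "x \<in> C" for x
    using that by (simp add: g_def f_inv_into_f)
  have fH: "f x \<in> topspace H" if "x \<in> C" for x
    using f that topC unfolding C_def continuous_map_def by blast
  have topK: "topspace K = g ` C"
    using fg fH by (auto simp: K_def topspace_pullback_topology)
  have "Hausdorff_space K"
    unfolding Hausdorff_space_def
  proof (intro allI impI, elim conjE)
    fix x y assume x: "x \<in> topspace K" and y: "y \<in> topspace K" and "x \<noteq> y"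
    then obtain a b where ab: "a \<in> C" "x = g a" "b \<in> C" "y = g b"
      using topK by auto
    with \<open>x \<noteq> y\<close> have "f x \<noteq> f y"
      by (metis comp_apply fg g_def)
    moreover have "f x \<in> topspace H" "f y \<in> topspace H"
      using ab fg fH by auto
    ultimately obtain V W where VW: "openin H V" "openin H W" "f x \<in> V" "f y \<in> W" "disjnt V W"
      using H unfolding Hausdorff_space_def by blast
    then have "openin K (f -` V \<inter> g ` C)" "openin K (f -` W \<inter> g ` C)"
      by (auto simp: K_def openin_pullback_topology)
    moreover have "disjnt (f -` V \<inter> g ` C) (f -` W \<inter> g ` C)"
      using VW(5) by (auto simp: disjnt_def)
    ultimately show "\<exists>V W. openin K V \<and> openin K W \<and> x \<in> V \<and> y \<in> W \<and> disjnt V W"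
      using VW x y topK by (metis IntI vimageI)
  qed
  moreover have "continuous_map (subtopology X C) K g"
    unfolding K_def
  proof (rule continuous_map_pullback')
    show "continuous_map (subtopology X C) H (f \<circ> g)"
      using continuous_map_eq[OF f[folded C_def]] fg topC by simp
  qed (use topC in auto)
  moreover have "finite {u \<in> U. g u = z}" if z: "z \<in> topspace K" for z
  proof -
    have "{u \<in> U. g u = z} \<subseteq> {u \<in> U. f u = f z}"
      using fg UC by auto
    moreover have "f z \<in> topspace H"
      using z topK fg fH by auto
    ultimately show ?thesis
      using fin finite_subset by blast
  qed
  ultimately show ?thesis
    using U unfolding weakly_sorted_def C_def by blast
qed

definition weakly_sortable :: "'a topology \<Rightarrow> bool" where
  "weakly_sortable X \<longleftrightarrow> (\<forall>x \<in> topspace X. \<exists>U. x \<in> U \<and> weakly_sorted X U)"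

end

theory Submission
  imports Defs
begin

text \<open>
  The idea is to look at \<open>NH(x)\<close> through weakly sorted neighbourhoods of its own points rather
  than of \<open>x\<close>. Let \<open>V\<close> be a weakly sorted neighbourhood of a point of \<open>NH(x)\<close>, with map \<open>f\<close>
  from the closure of \<open>V\<close> to a Hausdorff space. Then \<open>x\<close> lies in the closure of \<open>V\<close>, so \<open>f\<close> is
  defined at \<open>x\<close>, and \<open>f\<close> cannot tell \<open>x\<close> from any point of \<open>V\<close> not separated from it
  (\<open>nonseparated_point_of_open\<close>). Hence all of \<open>V \<inter> NH(x)\<close> lies in one fibre of \<open>f\<close> restricted
  to \<open>V\<close>, and such fibres are finite. Since \<open>V\<close> is Hausdorff, the finitely many points of
  \<open>NH(x)\<close> that it contains are isolated from each other by open subsets of \<open>V\<close>.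
\<close>

lemma nonseparated_point_of_open:
  assumes U: "openin X U" and H: "Hausdorff_space H"
    and f: "continuous_map (subtopology X (X closure_of U)) H f"
    and y: "y \<in> U" and x: "x \<in> topspace X" and nsep: "\<not> separated_points X x y"
  shows nonseparated_in_closure: "x \<in> X closure_of U"
    and nonseparated_same_image: "f x = f y"
proof -
  show xC: "x \<in> X closure_of U"
    unfolding in_closure_of
  proof (intro conjI x allI impI, elim conjE)
    fix T assume "x \<in> T" "openin X T"
    with nsep U y show "\<exists>z. z \<in> U \<and> z \<in> T"
      unfolding separated_points_def disjnt_iff by blast
  qed
  have UC: "U \<subseteq> X closure_of U"
    using U by (simp add: closure_of_subset openin_subset)
  show "f x = f y"
  proof (rule ccontr)
    assume "f x \<noteq> f y"
    moreover have "f x \<in> topspace H" "f y \<in> topspace H"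
      using f xC x y UC U openin_subset unfolding continuous_map_def by fastforce+
    ultimately obtain A B where AB: "openin H A" "openin H B" "f x \<in> A" "f y \<in> B" "disjnt A B"
      using H unfolding Hausdorff_space_def by blast
    have preimage: "\<exists>T. openin X T \<and> {z \<in> X closure_of U. f z \<in> W} = T \<inter> X closure_of U"
      if "openin H W" for W
    proof -
      have "topspace (subtopology X (X closure_of U)) = X closure_of U"
        by (simp add: Int_absorb1 closure_of_subset_topspace)
      then show ?thesis
        using openin_continuous_map_preimage[OF f that] by (simp add: openin_subtopology)
    qed
    obtain S where S: "openin X S" "{z \<in> X closure_of U. f z \<in> A} = S \<inter> X closure_of U"
      using preimage[OF AB(1)] by blast
    obtain T where T: "openin X T" "{z \<in> X closure_of U. f z \<in> B} = T \<inter> X closure_of U"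
      using preimage[OF AB(2)] by blast
    \<comment> \<open>Preimages under \<open>f\<close> are open only relative to the closure of \<open>U\<close>. Cutting one of the
      two down to \<open>U\<close> keeps the extensions to open sets of \<open>X\<close> disjoint.\<close>
    have "disjnt S (T \<inter> U)"
      using S(2) T(2) UC AB(5) unfolding disjnt_iff by blast
    moreover have "x \<in> S" "y \<in> T \<inter> U"
      using S(2) T(2) xC y UC AB(3,4) by auto
    moreover have "openin X (T \<inter> U)"
      using T(1) U by blast
    ultimately show False
      using nsep S(1) unfolding separated_points_def by blast
  qed
qed

lemma finite_weakly_sorted_Int_NH:
  assumes V: "weakly_sorted X V" and x: "x \<in> topspace X"
  shows "finite (V \<inter> NH X x)"
proof (cases "V \<inter> NH X x = {}")
  case False
  then obtain y where y: "y \<in> V" "y \<in> NH X x"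
    by blast
  obtain H :: "'a topology" and f where H: "Hausdorff_space H"
    and f: "continuous_map (subtopology X (X closure_of V)) H f"
    and fin: "\<And>z. z \<in> topspace H \<Longrightarrow> finite {u \<in> V. f u = z}"
    using V unfolding weakly_sorted_def by blast
  have V': "openin X V"
    using V by (simp add: weakly_sorted_def)
  have "x \<in> X closure_of V"
    using nonseparated_in_closure[OF V' H f y(1) x] y(2) by (simp add: NH_def)
  then have "f x \<in> topspace H"
    using f x unfolding continuous_map_def by auto
  moreover have "V \<inter> NH X x \<subseteq> {u \<in> V. f u = f x}"
    using nonseparated_same_image[OF V' H f _ x] by (force simp: NH_def)
  ultimately show ?thesis
    using fin finite_subset by blast
qed auto

text \<open>Finite subsets of a Hausdorff space are closed, so removing from \<open>V\<close> the other points
  of \<open>V \<inter> S\<close> leaves an open set whose only point of \<open>S\<close> is \<open>y\<close>.\<close>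

lemma discrete_if_locally_finite_in_Hausdorff:
  assumes S: "S \<subseteq> topspace X"
    and nbhd: "\<And>y. y \<in> S \<Longrightarrow>
      \<exists>V. openin X V \<and> y \<in> V \<and> Hausdorff_space (subtopology X V) \<and> finite (V \<inter> S)"
  shows "subtopology X S = discrete_topology S"
proof -
  have "openin (subtopology X S) {y}" if y: "y \<in> S" for y
  proof -
    obtain V where V: "openin X V" "y \<in> V" "Hausdorff_space (subtopology X V)" "finite (V \<inter> S)"
      using nbhd[OF y] by blast
    have topV: "topspace (subtopology X V) = V"
      using V(1) openin_subset by fastforce
    have "closedin (subtopology X V) (V \<inter> S - {y})"
      using V topV by (intro closedin_Hausdorff_finite) auto
    then have "openin (subtopology X V) (V - (V \<inter> S - {y}))"
      unfolding closedin_def topV by blast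
    then have "openin X (V - (V \<inter> S - {y}))"
      using V(1) by (simp add: openin_open_subtopology)
    moreover have "(V - (V \<inter> S - {y})) \<inter> S = {y}"
      using V(2) y by blast
    ultimately show ?thesis
      unfolding openin_subtopology by metis
  qed
  then have "discrete_topology S = subtopology X S"
    using S by (subst discrete_topology_unique) auto
  then show ?thesis ..
qed

theorem corollary4p5:
  fixes M :: "'a topology"
  assumes "manifold M" and "homogeneous M" and "weakly_sortable M"
  shows "\<forall>x \<in> topspace M. subtopology M (NH M x) = discrete_topology (NH M x)"
proof
  fix x assume x: "x \<in> topspace M"
  show "subtopology M (NH M x) = discrete_topology (NH M x)"
  proof (rule discrete_if_locally_finite_in_Hausdorff)
    show sub: "NH M x \<subseteq> topspace M"
      by (auto simp: NH_def)
    fix y assume "y \<in> NH M x"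
    then obtain V where V: "y \<in> V" "weakly_sorted M V"
      using assms(3) sub unfolding weakly_sortable_def by blast
    then show "\<exists>V. openin M V \<and> y \<in> V \<and> Hausdorff_space (subtopology M V) \<and> finite (V \<inter> NH M x)"
      using finite_weakly_sorted_Int_NH[OF V(2) x] unfolding weakly_sorted_def by blast
  qed
qed

end
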